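(* Let $R$ be a principal ideal domain. Let $f=\sum_{i=0}^\infty a_i z^i\in R[[z]]$ be such that $a_0=up_1^{k_1}\cdots p_r^{k_r}$ with $r\geq 2$, where $u$ is a unit in $R$, $p_1,\ldots,p_r$ are pairwise nonassociate primes in $R$, and $k_1,\ldots,k_r$ are positive integers. For each $i=1,\ldots,r$, let $R_{\mathfrak{p}_i}$ be the localization of $R$ at the prime ideal $\mathfrak{p}_i$ generated by $p_i$, with discrete valuation $v_i$ for which $p_i$ is a uniformizing parameter of $R_{\mathfrak{p}_i}$; each $v_i$ extends to the field of fractions of $R$ with valuation ring $R_{\mathfrak{p}_i}$. Suppose that for each $i=1,\ldots,r$ there exists a positive integer $n_i$ for which the following conditions are satisfied: (i) $v_i(a_{n_i})=0$ and $\gcd(k_i,n_i)=1$; (ii) $\frac{k_i}{n_i}<\frac{v_i(a_t)}{n_i-t}$ for each $t=1,\ldots,n_i-1$. Then $f$ is a product of exactly $r$ irreducible factors in $R[[z]]$.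
   Context: $R[[z]]$ denotes the ring of formal power series in $z$ over $R$; when $R$ is a principal ideal domain, $R[[z]]$ is a unique factorization domain, and irreducible factors are counted with multiplicity. The valuations are normalized so that $v_i(p_i)=1$, with $v_i(0)=\infty$. *)

theory Defs
  imports
    "HOL-Computational_Algebra.Computational_Algebra"
    "HOL-Library.Extended_Real"
begin

class pid = idom +
  assumes ideal_principal:
    "0 \<in> I \<Longrightarrow> (\<And>x y. x \<in> I \<Longrightarrow> y \<in> I \<Longrightarrow> x + y \<in> I) \<Longrightarrow> (\<And>c x. x \<in> I \<Longrightarrow> c * x \<in> I) \<Longrightarrow>
      \<exists>g. I = {c * g | c. True}"

definition associates :: "'a::idom \<Rightarrow> 'a \<Rightarrow> bool" where
  "associates a b \<longleftrightarrow> (\<exists>w. w dvd 1 \<and> a = w * b)"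

definition principal_ideal :: "'a::idom \<Rightarrow> 'a set" where
  "principal_ideal p = {c * p | c. True}"

(* The localization of R at a prime ideal P, as a subring of the field of fractions. *)
definition localization_at :: "'a::idom set \<Rightarrow> 'a fract set" where
  "localization_at P = {Fract a b | a b. b \<notin> P}"

(* The discrete valuation of the localization at (p), extended to the field of fractions:
   a nonzero x is written uniquely as p^k * s with s a unit of the localization, and its
   valuation is k. In the unit condition, x \<noteq> 0 excludes s = 0, for which inverse 0 = 0.
   The lemmas below show that, for p prime in a principal ideal domain, this is the
   valuation with v(p) = 1 whose valuation ring is the localization at (p). *)
definition val :: "'a::idom \<Rightarrow> 'a fract \<Rightarrow> ereal" where
  "val p x =
     (if x = 0 then \<infinity>
      else ereal (of_int (THE k::int.
        \<exists>s. s \<in> localization_at (principal_ideal p) \<and>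
            inverse s \<in> localization_at (principal_ideal p) \<and>
            x = to_fract p powi k * s)))"

lemma principal_ideal_iff: "x \<in> principal_ideal p \<longleftrightarrow> p dvd x"
  by (auto simp: principal_ideal_def dvd_def mult.commute)

lemma localization_iff:
  "x \<in> localization_at (principal_ideal p) \<longleftrightarrow> (\<exists>a b. \<not> p dvd b \<and> x = Fract a b)"
  by (auto simp: localization_at_def principal_ideal_iff)

lemma Fract_zero_iff: "b \<noteq> 0 \<Longrightarrow> Fract a b = 0 \<longleftrightarrow> (a::'a::idom) = 0"
  by (simp add: Zero_fract_def eq_fract)

lemma localization_mult:
  assumes "prime_elem p" "x \<in> localization_at (principal_ideal p)"
    "y \<in> localization_at (principal_ideal p)"
  shows "x * y \<in> localization_at (principal_ideal p)"
proof -
  obtain a b c d where "\<not> p dvd b" "x = Fract a b" "\<not> p dvd d" "y = Fract c d"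
    using assms(2,3) unfolding localization_iff by blast
  then have "x * y = Fract (a * c) (b * d)" "\<not> p dvd b * d"
    using assms(1) by (auto simp: prime_elem_dvd_mult_iff)
  then show ?thesis unfolding localization_iff by blast
qed

lemma localization_add:
  assumes "prime_elem p" "x \<in> localization_at (principal_ideal p)"
    "y \<in> localization_at (principal_ideal p)"
  shows "x + y \<in> localization_at (principal_ideal p)"
proof -
  obtain a b c d where *: "\<not> p dvd b" "x = Fract a b" "\<not> p dvd d" "y = Fract c d"
    using assms(2,3) unfolding localization_iff by blast
  then have "b \<noteq> 0" "d \<noteq> 0" by auto
  then have "x + y = Fract (a * d + c * b) (b * d)" "\<not> p dvd b * d"
    using assms(1) * by (auto simp: prime_elem_dvd_mult_iff)
  then show ?thesis unfolding localization_iff by blast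
qed

lemma to_fract_in_localization: "\<not> p dvd 1 \<Longrightarrow> to_fract a \<in> localization_at (principal_ideal p)"
  unfolding localization_iff to_fract_def by blast

lemma to_fract_power': "to_fract (x ^ n) = to_fract x ^ n"
  by (induction n) auto

lemma inverse_prime_notin_localization:
  assumes "prime_elem p"
  shows "inverse (to_fract p) \<notin> localization_at (principal_ideal p)"
proof
  assume "inverse (to_fract p) \<in> localization_at (principal_ideal p)"
  then obtain a b where ab: "\<not> p dvd b" "Fract 1 p = Fract a b"
    unfolding localization_iff to_fract_def by auto
  moreover have "p \<noteq> 0" "b \<noteq> 0" using assms ab by auto
  ultimately have "b = a * p" by (simp add: eq_fract)
  with ab show False by simp
qed

lemma localization_power:
  "prime_elem p \<Longrightarrow> x \<in> localization_at (principal_ideal p) \<Longrightarrow>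
    x ^ n \<in> localization_at (principal_ideal p)"
proof (induction n)
  case 0
  then show ?case
    using to_fract_in_localization[of p 1] by (auto simp: prime_elem_def)
qed (auto intro: localization_mult)

lemma val_exponent_unique:
  assumes p: "prime_elem p"
    and s: "s \<in> localization_at (principal_ideal p)" "inverse s \<in> localization_at (principal_ideal p)"
    and t: "t \<in> localization_at (principal_ideal p)" "inverse t \<in> localization_at (principal_ideal p)"
    and eq: "to_fract p powi k * s = to_fract p powi l * t" and nz: "s \<noteq> 0" "t \<noteq> 0"
  shows "k \<le> l"
proof (rule ccontr)
  assume "\<not> k \<le> l"
  define m where "m = nat (k - l - 1)"
  have m: "k - l = int (Suc m)" using \<open>\<not> k \<le> l\<close> by (simp add: m_def)
  have p0: "to_fract p \<noteq> 0" using p by auto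
  have "to_fract p powi (k - l) * s = t"
    using eq p0 by (simp add: power_int_diff field_simps)
  then have eq': "to_fract p * (to_fract p ^ m * s) = t"
    unfolding m power_int_of_nat by (simp add: mult.assoc)
  then have "inverse (to_fract p) = (to_fract p ^ m * s) * inverse t"
    using p0 nz by (auto simp: field_simps)
  moreover have "to_fract p ^ m * s * inverse t \<in> localization_at (principal_ideal p)"
    using p s t by (intro localization_mult localization_power to_fract_in_localization)
      (auto simp: prime_elem_def)
  ultimately show False using inverse_prime_notin_localization[OF p] by simp
qed

lemma val_eqI:
  assumes p: "prime_elem p"
    and s: "s \<in> localization_at (principal_ideal p)" "inverse s \<in> localization_at (principal_ideal p)"
    and nz: "s \<noteq> 0"
  shows "val p (to_fract p powi k * s) = ereal (of_int k)"
proof -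
  have p0: "to_fract p \<noteq> 0" using p by auto
  have "(THE l. \<exists>t. t \<in> localization_at (principal_ideal p) \<and>
            inverse t \<in> localization_at (principal_ideal p) \<and>
            to_fract p powi k * s = to_fract p powi l * t) = k"
  proof (rule the_equality)
    show "\<exists>t. t \<in> localization_at (principal_ideal p) \<and>
            inverse t \<in> localization_at (principal_ideal p) \<and>
            to_fract p powi k * s = to_fract p powi k * t" using s by blast
    fix l
    assume "\<exists>t. t \<in> localization_at (principal_ideal p) \<and>
            inverse t \<in> localization_at (principal_ideal p) \<and>
            to_fract p powi k * s = to_fract p powi l * t"
    then obtain t where t: "t \<in> localization_at (principal_ideal p)"
            "inverse t \<in> localization_at (principal_ideal p)"
            "to_fract p powi k * s = to_fract p powi l * t" by blast
    then have "t \<noteq> 0" using p0 nz by auto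
    then show "l = k"
      using val_exponent_unique[OF p s t(1,2,3) nz]
        val_exponent_unique[OF p t(1,2) s t(3)[symmetric] _ nz] by simp
  qed
  then show ?thesis using p0 nz by (simp add: val_def)
qed

lemma pid_prime_power_exponent:
  fixes p a :: "'a::pid"
  assumes p: "prime_elem p" and a: "a \<noteq> 0"
  shows "\<exists>k b. a = p ^ k * b \<and> \<not> p dvd b"
proof (rule ccontr)
  assume neg: "\<nexists>k b. a = p ^ k * b \<and> \<not> p dvd b"
  have "\<exists>c. a = p ^ n * c" for n
  proof (induction n)
    case (Suc n)
    then obtain c where c: "a = p ^ n * c" by blast
    with neg have "p dvd c" by blast
    then obtain d where "c = p * d" by (auto simp: dvd_def)
    with c have "a = p ^ Suc n * d" by (simp add: mult_ac)
    then show ?case by blast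
  qed simp
  then obtain c where c: "\<And>n. a = p ^ n * c n" by metis
  have p0: "p \<noteq> 0" using p by auto
  have step: "c n = p * c (Suc n)" for n
  proof -
    have "p ^ n * c n = p ^ n * (p * c (Suc n))"
      using c[of n] c[of "Suc n"] by (simp only: power_Suc2 mult.assoc)
    then show ?thesis using p0 by simp
  qed
  have mono: "n \<le> m \<Longrightarrow> c m dvd c n" for n m
  proof (induction m rule: dec_induct)
    case (step m)
    then show ?case using \<open>\<And>n. c n = p * c (Suc n)\<close> by (metis dvd_mult_left dvd_triv_right dvd_trans)
  qed simp
  define I where "I = {x. \<exists>n. c n dvd x}"
  have "\<exists>g. I = {d * g | d. True}"
  proof (rule ideal_principal)
    show "0 \<in> I" by (auto simp: I_def)
    fix x y assume "x \<in> I" "y \<in> I"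
    then obtain n m where "c n dvd x" "c m dvd y" by (auto simp: I_def)
    then have "c (max n m) dvd x" "c (max n m) dvd y"
      using mono[of n "max n m"] mono[of m "max n m"] by (auto intro: dvd_trans)
    then have "c (max n m) dvd x + y" by (rule dvd_add)
    then show "x + y \<in> I" unfolding I_def by blast
  next
    fix d x assume "x \<in> I"
    then show "d * x \<in> I" unfolding I_def by (blast intro: dvd_mult)
  qed
  then obtain g where g: "I = {d * g | d. True}" by blast
  have "g \<in> I" using g by (auto intro: exI[of _ 1])
  then obtain n where n: "c n dvd g" by (auto simp: I_def)
  have "c (Suc n) \<in> I" unfolding I_def by (blast intro: dvd_refl)
  then have "g dvd c (Suc n)" using g by auto
  with n have "c n dvd c (Suc n)" by (rule dvd_trans)
  then obtain y where "c (Suc n) = c n * y" by (auto simp: dvd_def)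
  then have "c (Suc n) * 1 = c (Suc n) * (p * y)"
    using step[of n] by (simp add: mult_ac)
  moreover have "c (Suc n) \<noteq> 0" using a c[of "Suc n"] by auto
  ultimately have "1 = p * y" by (metis mult_cancel_left)
  then have "p dvd 1" by (metis dvd_triv_left)
  then show False using p by (simp add: prime_elem_def)
qed

lemma val_exponent_exists:
  fixes p :: "'a::pid"
  assumes p: "prime_elem p" and x: "x \<noteq> 0"
  obtains k s where "s \<in> localization_at (principal_ideal p)"
    "inverse s \<in> localization_at (principal_ideal p)" "s \<noteq> 0" "x = to_fract p powi k * s"
proof -
  obtain a b where ab: "x = Fract a b" "b \<noteq> 0" "a \<noteq> 0"
    using x by (metis Fract_cases_nonzero)
  obtain k a' where a': "a = p ^ k * a'" "\<not> p dvd a'"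
    using pid_prime_power_exponent[OF p ab(3)] by blast
  obtain l b' where b': "b = p ^ l * b'" "\<not> p dvd b'"
    using pid_prime_power_exponent[OF p ab(2)] by blast
  have nz: "a' \<noteq> 0" "b' \<noteq> 0" "p \<noteq> 0" using ab a' b' p by auto
  have F: "Fract u w = to_fract u / to_fract w" for u w :: 'a
    by (simp add: to_fract_def)
  have "x = to_fract p powi (int k - int l) * Fract a' b'"
    using nz by (simp add: ab(1) F a' b' to_fract_power' power_int_diff)
  moreover have "Fract a' b' \<in> localization_at (principal_ideal p)"
    "inverse (Fract a' b') \<in> localization_at (principal_ideal p)"
    unfolding localization_iff inverse_fract using a' b' by blast+
  moreover have "Fract a' b' \<noteq> 0" using nz by (simp add: Fract_zero_iff)
  ultimately show ?thesis using that by blast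
qed

lemma val_uniformizer:
  assumes "prime_elem p" shows "val p (to_fract p) = 1"
proof -
  have 1: "1 \<in> localization_at (principal_ideal p)"
    using to_fract_in_localization[of p 1] assms by (auto simp: prime_elem_def)
  then show ?thesis using val_eqI[OF assms 1, of 1] by (simp add: one_ereal_def)
qed

lemma val_mult:
  fixes p :: "'a::pid"
  assumes p: "prime_elem p" shows "val p (x * y) = val p x + val p y"
proof (cases "x = 0 \<or> y = 0")
  case True
  have "val p z \<noteq> -\<infinity>" for z by (simp add: val_def)
  with True show ?thesis by (auto simp: val_def)
next
  case False
  obtain k s where s: "s \<in> localization_at (principal_ideal p)"
    "inverse s \<in> localization_at (principal_ideal p)" "s \<noteq> 0" "x = to_fract p powi k * s"
    using val_exponent_exists[OF p, of x] False by blast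
  obtain l t where t: "t \<in> localization_at (principal_ideal p)"
    "inverse t \<in> localization_at (principal_ideal p)" "t \<noteq> 0" "y = to_fract p powi l * t"
    using val_exponent_exists[OF p, of y] False by blast
  have "to_fract p \<noteq> 0" using p by auto
  then have "x * y = to_fract p powi (k + l) * (s * t)"
    using s t by (simp add: power_int_add)
  moreover have "val p (to_fract p powi (k + l) * (s * t)) = ereal (of_int (k + l))"
    using s t by (intro val_eqI p) (auto intro: localization_mult p)
  moreover have "val p x = ereal (of_int k)" "val p y = ereal (of_int l)"
    unfolding s(4) t(4) by (intro val_eqI p s(1-3) t(1-3))+
  ultimately show ?thesis by simp
qed

lemma val_nonneg_iff:
  fixes p :: "'a::pid"
  assumes p: "prime_elem p" shows "0 \<le> val p x \<longleftrightarrow> x \<in> localization_at (principal_ideal p)"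
proof (cases "x = 0")
  case True
  then show ?thesis
    using to_fract_in_localization[of p 0] p by (auto simp: val_def prime_elem_def)
next
  case False
  obtain k s where s: "s \<in> localization_at (principal_ideal p)"
    "inverse s \<in> localization_at (principal_ideal p)" "s \<noteq> 0" "x = to_fract p powi k * s"
    using val_exponent_exists[OF p False] by blast
  have v: "val p x = ereal (of_int k)" using val_eqI[OF p s(1-3)] s by simp
  have pl: "to_fract p \<in> localization_at (principal_ideal p)"
    using to_fract_in_localization[of p p] p by (auto simp: prime_elem_def)
  have p0: "to_fract p \<noteq> 0" using p by auto
  show ?thesis
  proof
    assume "0 \<le> val p x"
    then have "x = to_fract p ^ nat k * s" using s v by (simp add: power_int_def)
    then show "x \<in> localization_at (principal_ideal p)"
      using localization_mult[OF p localization_power[OF p pl] s(1)] by simp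
  next
    assume x: "x \<in> localization_at (principal_ideal p)"
    show "0 \<le> val p x"
    proof (rule ccontr)
      assume "\<not> 0 \<le> val p x"
      then have "k < 0" using v by simp
      define m where "m = nat (- k - 1)"
      have "k = - int (Suc m)" using \<open>k < 0\<close> by (simp add: m_def)
      then have "x = inverse (to_fract p ^ Suc m) * s"
        using s by (simp only: power_int_minus power_int_of_nat)
      then have "inverse (to_fract p) = to_fract p ^ m * (x * inverse s)"
        using p0 s(3) by (simp add: field_simps)
      moreover have "to_fract p ^ m * (x * inverse s) \<in> localization_at (principal_ideal p)"
        by (intro localization_mult localization_power p pl x s)
      ultimately show False using inverse_prime_notin_localization[OF p] by simp
    qed
  qed
qed

lemma val_add:
  fixes p :: "'a::pid"
  assumes p: "prime_elem p" shows "min (val p x) (val p y) \<le> val p (x + y)"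
proof -
  have *: "val p x \<le> val p (x + y)" if le: "val p x \<le> val p y" for x y
  proof (cases "x = 0")
    case True
    then show ?thesis using le by simp
  next
    case False
    have "val p (y / x) + val p x = val p y" using False val_mult[OF p, of "y / x" x] by simp
    moreover have "\<bar>val p x\<bar> \<noteq> \<infinity>" using False by (simp add: val_def)
    ultimately have "0 \<le> val p (y / x)" using le
      by (cases "val p x"; cases "val p (y / x)"; cases "val p y") auto
    moreover have "1 \<in> localization_at (principal_ideal p)"
      using to_fract_in_localization[of p 1] p by (auto simp: prime_elem_def)
    ultimately have "0 \<le> val p (1 + y / x)"
      using localization_add[OF p] val_nonneg_iff[OF p] by blast
    moreover have "x + y = x * (1 + y / x)" using False by (simp add: field_simps)
    ultimately have "val p x + 0 \<le> val p (x + y)"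
      using val_mult[OF p, of x "1 + y / x"] by (simp only: add_left_mono)
    then show ?thesis by simp
  qed
  show ?thesis
    using *[of x y] *[of y x] by (cases "val p x \<le> val p y") (auto simp: min_def add.commute)
qed

end

theory Submission
  imports Defs
begin

text \<open>
  A power series is a unit exactly when its constant coefficient is, so every nonunit factor
  \<open>g\<close> of \<open>f\<close> has a constant coefficient divisible by one of the primes \<open>p\<^sub>i\<close>
  that occur in \<open>a\<^sub>0\<close>. The theorem says that the irreducible factors of \<open>f\<close> correspond
  to these primes bijectively. Two facts give this correspondence.

  No prime is shared by two factors (\<open>prime_not_dvd_both_const_coeffs\<close>). The hypotheses say that
  the Newton polygon of \<open>f\<close> at \<open>p\<^sub>i\<close>, from \<open>(0, k\<^sub>i)\<close> to \<open>(n\<^sub>i, 0)\<close>, is one segment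
  without interior lattice points, since \<open>k\<^sub>i\<close> and \<open>n\<^sub>i\<close> are coprime. If \<open>f = G H\<close> with
  both constant coefficients divisible by \<open>p\<^sub>i\<close>, then both factors contribute to the
  horizontal extent \<open>n\<^sub>i\<close>, and either an interior lattice point lies on the segment or some
  product of coefficients of \<open>G\<close> and \<open>H\<close> lies strictly below it. In the second case
  \<open>f\<close> itself has a coefficient below the segment, because minimal weights
  \<open>n v(x\<^sub>t) + k t\<close> add up under multiplication (\<open>weight_mult_le\<close>).

  No irreducible factor involves two primes (\<open>irreducible_fps_const_primes_eq\<close>). A factorization
  of the constant coefficient into two comaximal elements lifts to a factorization of the series
  (\<open>fps_coprime_lift\<close>), so an irreducible series has a prime power, up to a unit, as its
  constant coefficient, unless that is 0.

  Counting the pairs of a factor and a prime that divides its constant coefficient in two ways then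
  shows that a factorization into irreducibles has exactly \<open>r\<close> factors. By the same count, a
  factorization into nonunits has at most \<open>r\<close> factors; hence one with the largest possible
  number of factors exists, and its factors are irreducible.
\<close>

section \<open>Arithmetic in principal ideal domains\<close>

text \<open>
  A generator of the ideal \<open>(p, c)\<close> divides \<open>p\<close> but is not a multiple of \<open>p\<close>; by
  primality the cofactor is, so the generator is a unit.
\<close>

lemma pid_prime_bezout:
  fixes p c :: "'a::pid"
  assumes p: "prime_elem p" and c: "\<not> p dvd c"
  shows "\<exists>x y. x * p + y * c = 1"
proof -
  define I where "I = {x * p + y * c | x y. True}"
  have "\<exists>g. I = {d * g | d. True}"
  proof (rule ideal_principal)
    show "0 \<in> I" by (auto simp: I_def intro!: exI[of _ 0])
    fix s t assume "s \<in> I" "t \<in> I"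
    then obtain x y x' y' where "s = x * p + y * c" "t = x' * p + y' * c"
      by (auto simp: I_def)
    then have "s + t = (x + x') * p + (y + y') * c" by (simp add: algebra_simps)
    then show "s + t \<in> I" unfolding I_def by blast
  next
    fix d s assume "s \<in> I"
    then obtain x y where "s = x * p + y * c" by (auto simp: I_def)
    then have "d * s = (d * x) * p + (d * y) * c" by (simp add: algebra_simps)
    then show "d * s \<in> I" unfolding I_def by blast
  qed
  then obtain g where g: "I = {d * g | d. True}" by blast
  have "p = 1 * p + 0 * c" "c = 0 * p + 1 * c" by simp_all
  then have "p \<in> I" "c \<in> I" unfolding I_def by blast+
  then have "g dvd p" "g dvd c" using g by auto
  then have "\<not> p dvd g" using c dvd_trans by blast
  obtain d where d: "p = g * d" using \<open>g dvd p\<close> by (auto simp: dvd_def)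
  with p \<open>\<not> p dvd g\<close> have "p dvd d" by (metis dvd_refl prime_elem_dvd_multD)
  then obtain e where "d = p * e" by (auto simp: dvd_def)
  with d have "p * 1 = p * (e * g)" by (simp add: mult_ac)
  then have "1 = e * g" using p by (metis mult_cancel_left prime_elem_not_zeroI)
  then have "1 \<in> I" unfolding g by blast
  then show ?thesis unfolding I_def by force
qed

text \<open>Bezout identities for \<open>p\<^sup>n\<close> and for \<open>p\<close> multiply to one for the next power.\<close>

lemma pid_prime_power_bezout:
  fixes p c :: "'a::pid"
  assumes p: "prime_elem p" and c: "\<not> p dvd c"
  shows "\<exists>x y. x * p ^ n + y * c = 1"
proof (induction n)
  case 0
  have "1 * p ^ 0 + 0 * c = 1" by simp
  then show ?case by blast
next
  case (Suc n)
  then obtain x y where n: "x * p ^ n + y * c = 1" by blast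
  obtain x' y' where 1: "x' * p + y' * c = 1" using pid_prime_bezout[OF assms] by blast
  have "(x * x') * p ^ Suc n + (x * p ^ n * y' + y * (x' * p + y' * c)) * c
      = (x * p ^ n + y * c) * (x' * p + y' * c)"
    by (simp add: algebra_simps)
  also have "\<dots> = 1" by (simp add: n 1)
  finally show ?case by blast
qed

lemma dvd_of_dvd_prime_power_mult:
  fixes p x z :: "'a::idom"
  assumes p: "prime_elem p" and x: "\<not> p dvd x" and "x dvd p ^ n * z"
  shows "x dvd z"
  using assms(3)
proof (induction n)
  case (Suc n)
  then obtain y where y: "p ^ Suc n * z = x * y" by (auto simp: dvd_def)
  have "p dvd x * y" using y by (metis dvd_mult2 dvd_triv_left power_Suc)
  with p x have "p dvd y" by (metis prime_elem_dvd_multD)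
  then obtain y' where "y = p * y'" by (auto simp: dvd_def)
  with y have "p * (p ^ n * z) = p * (x * y')" by (simp add: mult_ac)
  then have "p ^ n * z = x * y'" using p by (metis mult_cancel_left prime_elem_not_zeroI)
  then show ?case using Suc.IH by simp
qed simp

text \<open>
  A divisor prime to all \<open>p\<^sub>i\<close> can be cancelled past one prime power after another until it
  divides \<open>u\<close>.
\<close>

lemma nonunit_dvd_imp_prime_dvd:
  fixes p :: "'i \<Rightarrow> 'a::idom"
  assumes "finite I" "\<And>i. i \<in> I \<Longrightarrow> prime_elem (p i)" "u dvd 1" "\<not> x dvd 1"
    "x dvd u * (\<Prod>i\<in>I. p i ^ k i)"
  shows "\<exists>i\<in>I. p i dvd x"
proof (rule ccontr)
  assume neg: "\<not> (\<exists>i\<in>I. p i dvd x)"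
  have "x dvd u"
    using assms(1,2,5) neg
  proof (induction I rule: finite_induct)
    case (insert i I)
    then have "x dvd p i ^ k i * (u * (\<Prod>i\<in>I. p i ^ k i))" by (simp add: mult_ac)
    moreover have "prime_elem (p i)" "\<not> p i dvd x" using insert.prems by auto
    ultimately have "x dvd u * (\<Prod>i\<in>I. p i ^ k i)"
      using dvd_of_dvd_prime_power_mult by blast
    then show ?case using insert.IH insert.prems by blast
  qed simp
  then show False using assms(3,4) dvd_trans by blast
qed

lemma prime_dvd_prime_imp_associates:
  assumes p: "prime_elem p" and q: "prime_elem q" and "q dvd p"
  shows "associates p q"
proof -
  obtain w where w: "p = q * w" using \<open>q dvd p\<close> by (auto simp: dvd_def)
  have "\<not> p dvd q"  if "\<not> w dvd 1"
  proof
    assume "p dvd q"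
    then obtain v where "q = p * v" by (auto simp: dvd_def)
    with w have "q * 1 = q * (w * v)" by (metis mult.assoc mult_1_right)
    then have "1 = w * v" using q by (metis mult_cancel_left prime_elem_not_zeroI)
    with that show False by (metis dvd_triv_left)
  qed
  moreover have "\<not> p dvd w"
  proof
    assume "p dvd w"
    then obtain v where "w = p * v" by (auto simp: dvd_def)
    with w have "p * 1 = p * (q * v)" by (metis mult.left_commute mult_1_right)
    then have "1 = q * v" using p by (metis mult_cancel_left prime_elem_not_zeroI)
    with q show False by (metis dvd_triv_left prime_elem_not_unit)
  qed
  ultimately have "w dvd 1" using p w by (metis dvd_refl prime_elem_dvd_multD)
  then show ?thesis using w unfolding associates_def by (metis mult.commute)
qed

section \<open>Units and coprime lifting in power series rings\<close>

lemma fps_dvd_1_iff_nth_0: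
  fixes f :: "'a::comm_ring_1 fps"
  shows "f dvd 1 \<longleftrightarrow> fps_nth f 0 dvd 1"
proof
  assume "f dvd 1"
  then obtain g where "1 = f * g" by (auto simp: dvd_def)
  then have "fps_nth f 0 * fps_nth g 0 = 1" by (metis fps_mult_nth_0 fps_one_nth)
  then show "fps_nth f 0 dvd 1" by (metis dvd_triv_left)
next
  assume "fps_nth f 0 dvd 1"
  then obtain y where "fps_nth f 0 * y = 1" by (auto simp: dvd_def)
  then have "f * fps_right_inverse f y = 1" by (rule fps_right_inverse)
  then show "f dvd 1" by (metis dvd_triv_left)
qed

text \<open>
  If \<open>x b + y c = 1\<close>, the coefficients of two series with product \<open>f\<close> and constant
  coefficients \<open>b\<close> and \<open>c\<close> can be chosen one degree at a time. In degree \<open>n\<close>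
  the new coefficients \<open>g\<^sub>n\<close> and \<open>h\<^sub>n\<close> must satisfy \<open>b h\<^sub>n + c g\<^sub>n = d\<close>,
  where \<open>d\<close> depends only on lower degrees; \<open>g\<^sub>n = y d\<close> and \<open>h\<^sub>n = x d\<close>
  are a solution.
\<close>

fun lift_coeffs :: "'a::comm_ring_1 fps \<Rightarrow> 'a \<Rightarrow> 'a \<Rightarrow> 'a \<Rightarrow> 'a \<Rightarrow> nat \<Rightarrow> 'a \<times> 'a" where
  "lift_coeffs f b c x y n =
     (if n = 0 then (b, c)
      else let d = fps_nth f n
             - (\<Sum>i\<in>{1..<n}. fst (lift_coeffs f b c x y i) * snd (lift_coeffs f b c x y (n - i)))
           in (y * d, x * d))"

declare lift_coeffs.simps [simp del]

text \<open>
  This is Hensel's lemma for the ideal generated by the variable: a comaximal factorization modulo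
  that ideal lifts, since power series are complete with respect to it.
\<close>

lemma fps_coprime_lift:
  fixes f :: "'a::comm_ring_1 fps"
  assumes f0: "fps_nth f 0 = b * c" and bez: "x * b + y * c = 1"
  shows "\<exists>g h. f = g * h \<and> fps_nth g 0 = b \<and> fps_nth h 0 = c"
proof -
  define L where "L = lift_coeffs f b c x y"
  define g where "g = Abs_fps (\<lambda>n. fst (L n))"
  define h where "h = Abs_fps (\<lambda>n. snd (L n))"
  have L0: "L 0 = (b, c)" unfolding L_def by (subst lift_coeffs.simps) simp
  have "fps_nth f n = fps_nth (g * h) n" for n
  proof (cases "n = 0")
    case True
    then show ?thesis by (simp add: g_def h_def L0 f0)
  next
    case False
    define S where "S = (\<Sum>i\<in>{1..<n}. fst (L i) * snd (L (n - i)))"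
    have Ln: "L n = (y * (fps_nth f n - S), x * (fps_nth f n - S))"
      using False unfolding L_def S_def by (subst lift_coeffs.simps) (simp add: Let_def)
    have "{0..n} = insert 0 (insert n {1..<n})" using False by auto
    then have "fps_nth (g * h) n = b * snd (L n) + (fst (L n) * c + S)"
      using False by (simp add: fps_mult_nth g_def h_def L0 S_def)
    also have "\<dots> = (x * b + y * c) * (fps_nth f n - S) + S"
      by (simp add: Ln algebra_simps)
    finally show ?thesis by (simp add: bez)
  qed
  then have "f = g * h" by (simp add: fps_eq_iff)
  moreover have "fps_nth g 0 = b" "fps_nth h 0 = c" by (simp_all add: g_def h_def L0)
  ultimately show ?thesis by blast
qed

text \<open>
  Otherwise the full power of \<open>p\<close> in the constant coefficient and its cofactor, which is
  divisible by \<open>q\<close>, would be comaximal nonunits, and their product would lift.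
\<close>

lemma irreducible_fps_const_primes_eq:
  fixes g :: "'a::pid fps"
  assumes g: "irreducible g" and g0: "fps_nth g 0 \<noteq> 0"
    and p: "prime_elem p" "p dvd fps_nth g 0" and q: "prime_elem q" "q dvd fps_nth g 0"
  shows "associates p q"
proof (rule ccontr)
  assume na: "\<not> associates p q"
  obtain n c where c: "fps_nth g 0 = p ^ n * c" "\<not> p dvd c"
    using pid_prime_power_exponent[OF p(1) g0] by blast
  have "\<not> q dvd p ^ n"
    using prime_dvd_prime_imp_associates[OF p(1) q(1)] prime_elem_dvd_power[OF q(1)] na by blast
  with q c(1) have "q dvd c" by (metis prime_elem_dvd_multD)
  have "n \<noteq> 0" using c p(2) by (intro notI) simp
  obtain x y where "x * p ^ n + y * c = 1" using pid_prime_power_bezout[OF p(1) c(2)] by blast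
  then obtain g1 g2 where "g = g1 * g2" "fps_nth g1 0 = p ^ n" "fps_nth g2 0 = c"
    using fps_coprime_lift[OF c(1)] by blast
  moreover have "\<not> p ^ n dvd 1"
    using \<open>n \<noteq> 0\<close> p(1) by (metis dvd_power dvd_trans neq0_conv prime_elem_not_unit)
  moreover have "\<not> c dvd 1" using \<open>q dvd c\<close> q(1) by (metis dvd_trans prime_elem_not_unit)
  ultimately show False using irreducibleD[OF g] fps_dvd_1_iff_nth_0 by metis
qed

section \<open>Weights of coefficients and Newton polygons\<close>

text \<open>
  A nonzero coefficient of degree \<open>t\<close> and \<open>p\<close>-adic valuation \<open>v\<close> has weight
  \<open>N v + K t\<close>; the points of weight at least \<open>w\<close> form a half-plane above a line of
  slope \<open>- K / N\<close>. Valuations enter only through the condition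
  \<open>\<not> p ^ Suc e dvd x\<close>, which says that \<open>x\<close> is nonzero and has valuation at most
  \<open>e\<close>. In this form zero coefficients need no special treatment.
\<close>

text \<open>
  The coefficient selected here has minimal weight, and among those the lowest degree. Its
  valuation is exactly \<open>a0\<close>, because a smaller one would lower the weight.
\<close>

lemma min_weight_coeff:
  fixes G :: "'a::comm_semiring_1 fps"
  assumes "N > 0" and "\<not> p ^ Suc a dvd fps_nth G i"
  obtains i0 a0 where "\<not> p ^ Suc a0 dvd fps_nth G i0" "p ^ a0 dvd fps_nth G i0"
    "N * a0 + K * i0 \<le> N * a + K * i"
    "\<And>i' a'. \<not> p ^ Suc a' dvd fps_nth G i' \<Longrightarrow> N * a0 + K * i0 \<le> N * a' + K * i'"
    "\<And>i' a'. \<not> p ^ Suc a' dvd fps_nth G i' \<Longrightarrow> i' < i0 \<Longrightarrow> N * a0 + K * i0 < N * a' + K * i'"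
proof -
  define P where "P = (\<lambda>(i, a). \<not> p ^ Suc a dvd fps_nth G i)"
  define w where "w = (\<lambda>(i, a). N * a + K * i)"
  have "P (i, a)" using assms by (simp add: P_def)
  then obtain z where z: "P z" "\<And>z'. P z' \<Longrightarrow> w z \<le> w z'"
    using ex_has_least_nat[of P "(i, a)" w] by blast
  define Q where "Q = (\<lambda>z'. P z' \<and> w z' = w z)"
  have "Q z" using z by (simp add: Q_def)
  then obtain z0 where z0: "Q z0" "\<And>z'. Q z' \<Longrightarrow> fst z0 \<le> fst z'"
    using ex_has_least_nat[of Q z fst] by blast
  obtain i0 a0 where ia: "z0 = (i0, a0)" by (cases z0)
  have le: "N * a0 + K * i0 \<le> N * a' + K * i'" if "\<not> p ^ Suc a' dvd fps_nth G i'" for i' a'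
    using z(2)[of "(i', a')"] that z0(1) by (simp add: P_def w_def Q_def ia)
  show ?thesis
  proof (rule that)
    show np: "\<not> p ^ Suc a0 dvd fps_nth G i0" using z0(1) by (simp add: Q_def P_def ia)
    show "p ^ a0 dvd fps_nth G i0"
    proof (cases a0)
      case (Suc e)
      then show ?thesis using le[of e i0] assms(1) by fastforce
    qed simp
    show "N * a0 + K * i0 \<le> N * a + K * i" using le assms(2) by blast
    show "N * a0 + K * i0 < N * a' + K * i'" if "\<not> p ^ Suc a' dvd fps_nth G i'" "i' < i0" for i' a'
    proof (rule ccontr)
      assume "\<not> N * a0 + K * i0 < N * a' + K * i'"
      then have "Q (i', a')"
        using le[OF that(1)] that(1) z0(1) by (simp add: Q_def P_def w_def ia)
      then show False using z0(2) that(2) by (force simp: ia)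
    qed
  qed (rule le)
qed

text \<open>
  A form of Gauss's lemma. Let \<open>i0\<close> and \<open>j0\<close> be the lowest degrees of minimal weight in
  the two factors. In the coefficient of degree \<open>i0 + j0\<close> of the product, every summand
  other than the one from \<open>i0\<close> and \<open>j0\<close> takes a coefficient of degree below
  \<open>i0\<close> or below \<open>j0\<close>, so it has larger weight and therefore larger valuation.
  The summands cannot cancel the one of minimal weight.
\<close>

lemma weight_mult_le:
  fixes G H :: "'a::pid fps"
  assumes p: "prime_elem p" and N: "N > 0"
    and G: "\<not> p ^ Suc a dvd fps_nth G i" and H: "\<not> p ^ Suc b dvd fps_nth H j"
  shows "\<exists>t e. \<not> p ^ Suc e dvd fps_nth (G * H) t \<and>
           N * e + K * t \<le> (N * a + K * i) + (N * b + K * j)"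
proof -
  obtain i0 a0 where g: "\<not> p ^ Suc a0 dvd fps_nth G i0" "p ^ a0 dvd fps_nth G i0"
    "N * a0 + K * i0 \<le> N * a + K * i"
    "\<And>i' a'. \<not> p ^ Suc a' dvd fps_nth G i' \<Longrightarrow> N * a0 + K * i0 \<le> N * a' + K * i'"
    "\<And>i' a'. \<not> p ^ Suc a' dvd fps_nth G i' \<Longrightarrow> i' < i0 \<Longrightarrow> N * a0 + K * i0 < N * a' + K * i'"
    using min_weight_coeff[where K=K, OF N G] by metis
  obtain j0 b0 where h: "\<not> p ^ Suc b0 dvd fps_nth H j0" "p ^ b0 dvd fps_nth H j0"
    "N * b0 + K * j0 \<le> N * b + K * j"
    "\<And>i' a'. \<not> p ^ Suc a' dvd fps_nth H i' \<Longrightarrow> N * b0 + K * j0 \<le> N * a' + K * i'"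
    "\<And>i' a'. \<not> p ^ Suc a' dvd fps_nth H i' \<Longrightarrow> i' < j0 \<Longrightarrow> N * b0 + K * j0 < N * a' + K * i'"
    using min_weight_coeff[where K=K, OF N H] by metis
  have other: "p ^ Suc (a0 + b0) dvd fps_nth G i' * fps_nth H (i0 + j0 - i')"
    if i': "i' \<le> i0 + j0" "i' \<noteq> i0" for i'
  proof (cases "fps_nth G i' = 0 \<or> fps_nth H (i0 + j0 - i') = 0")
    case False
    define j' where "j' = i0 + j0 - i'"
    obtain v c where v: "fps_nth G i' = p ^ v * c" "\<not> p dvd c"
      using pid_prime_power_exponent[OF p] False by blast
    obtain v' c' where v': "fps_nth H j' = p ^ v' * c'" "\<not> p dvd c'"
      using pid_prime_power_exponent[OF p] False unfolding j'_def by blast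
    have p0: "p \<noteq> 0" using p by auto
    have nG: "\<not> p ^ Suc v dvd fps_nth G i'" and nH: "\<not> p ^ Suc v' dvd fps_nth H j'"
      using v v' p0 by (simp_all only: power_Suc2 dvd_mult_cancel_left) auto
    have "i' < i0 \<or> j' < j0" using i' by (auto simp: j'_def)
    then have "(N * a0 + K * i0) + (N * b0 + K * j0) < (N * v + K * i') + (N * v' + K * j')"
      using g(4)[OF nG] g(5)[OF nG] h(4)[OF nH] h(5)[OF nH] by linarith
    moreover have "K * i0 + K * j0 = K * i' + K * j'"
      using i' by (simp add: j'_def flip: add_mult_distrib2)
    ultimately have "N * (a0 + b0) < N * (v + v')" by (simp add: add_mult_distrib2)
    then have "Suc (a0 + b0) \<le> v + v'" by simp
    then have "p ^ Suc (a0 + b0) dvd p ^ (v + v')" by (rule le_imp_power_dvd)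
    also have "p ^ (v + v') dvd fps_nth G i' * fps_nth H j'"
      by (simp add: v v' power_add mult_dvd_mono)
    finally show ?thesis by (simp only: j'_def)
  qed auto
  have main: "\<not> p ^ Suc (a0 + b0) dvd fps_nth G i0 * fps_nth H j0"
  proof -
    obtain c d where c: "fps_nth G i0 = p ^ a0 * c" and d: "fps_nth H j0 = p ^ b0 * d"
      using g(2) h(2) by (auto simp: dvd_def)
    have p0: "p \<noteq> 0" using p by auto
    have "\<not> p dvd c" "\<not> p dvd d" using g(1) h(1) by (auto simp: c d)
    then have "\<not> p dvd c * d" using p by (simp add: prime_elem_dvd_mult_iff)
    moreover have "fps_nth G i0 * fps_nth H j0 = p ^ (a0 + b0) * (c * d)"
      by (simp add: c d power_add mult_ac)
    ultimately show ?thesis using p0 by (simp only: power_Suc2 dvd_mult_cancel_left) auto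
  qed
  have "fps_nth (G * H) (i0 + j0) = fps_nth G i0 * fps_nth H j0
      + (\<Sum>i'\<in>{0..i0 + j0} - {i0}. fps_nth G i' * fps_nth H (i0 + j0 - i'))"
    by (subst fps_mult_nth, subst sum.remove[of _ i0]) auto
  moreover have "p ^ Suc (a0 + b0) dvd
      (\<Sum>i'\<in>{0..i0 + j0} - {i0}. fps_nth G i' * fps_nth H (i0 + j0 - i'))"
    by (rule dvd_sum, rule other) auto
  ultimately have "\<not> p ^ Suc (a0 + b0) dvd fps_nth (G * H) (i0 + j0)"
    using main by (simp only: dvd_add_left_iff not_False_eq_True)
  moreover have "N * (a0 + b0) + K * (i0 + j0) \<le> (N * a + K * i) + (N * b + K * j)"
    using g(3) h(3) by (simp add: add_mult_distrib2)
  ultimately show ?thesis by blast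
qed

text \<open>
  Suppose that \<open>p\<close> divides both constant coefficients, with exact exponents \<open>a\<close> and
  \<open>b\<close>, so that \<open>a + b \<le> k\<close>. As \<open>p\<close> does not divide the coefficient of degree
  \<open>n\<close>, there are \<open>i\<close> and \<open>j\<close> with \<open>i + j = n\<close> such that it divides neither
  \<open>G\<^sub>i\<close> nor \<open>H\<^sub>j\<close>, and both are positive. Since \<open>n a + n b \<le> k i + k j\<close> and
  coprimality rules out \<open>n a = k i\<close>, one of \<open>n a < k i\<close> and \<open>n b < k j\<close> holds.
  Pairing the constant coefficient of that factor with the degree \<open>j\<close> or \<open>i\<close> coefficient
  of the other one gives a total weight below \<open>n k\<close>, the smallest weight allowed in the product.
\<close>

lemma prime_not_dvd_both_const_coeffs:
  fixes G H :: "'a::pid fps"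
  assumes p: "prime_elem p" and n: "n > 0" and kn: "gcd k n = 1"
    and weight: "\<And>t e. \<not> p ^ Suc e dvd fps_nth (G * H) t \<Longrightarrow> n * k \<le> n * e + k * t"
    and f0: "\<not> p ^ Suc k dvd fps_nth (G * H) 0"
    and fn: "\<not> p dvd fps_nth (G * H) n"
  shows "\<not> (p dvd fps_nth G 0 \<and> p dvd fps_nth H 0)"
proof
  assume pd: "p dvd fps_nth G 0 \<and> p dvd fps_nth H 0"
  have p0: "p \<noteq> 0" using p by auto
  have "fps_nth G 0 \<noteq> 0" "fps_nth H 0 \<noteq> 0" using f0 by auto
  then obtain a c b d where c: "fps_nth G 0 = p ^ a * c" "\<not> p dvd c"
    and d: "fps_nth H 0 = p ^ b * d" "\<not> p dvd d"
    using pid_prime_power_exponent[OF p] by metis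
  have nG: "\<not> p ^ Suc a dvd fps_nth G 0" and nH: "\<not> p ^ Suc b dvd fps_nth H 0"
    using c d p0 by (simp_all only: power_Suc2 dvd_mult_cancel_left) auto
  have "p ^ (a + b) dvd fps_nth (G * H) 0" by (simp add: c d power_add mult_dvd_mono)
  then have ab: "a + b \<le> k"
    using f0 by (meson dvd_trans le_imp_power_dvd not_less_eq_eq)
  obtain i where i: "i \<le> n" "\<not> p dvd fps_nth G i * fps_nth H (n - i)"
    using fn unfolding fps_mult_nth by (meson atLeastAtMost_iff dvd_sum)
  define j where "j = n - i"
  have Gi: "\<not> p ^ Suc 0 dvd fps_nth G i" and Hj: "\<not> p ^ Suc 0 dvd fps_nth H j"
    using i(2) by (auto simp: j_def)
  have ij: "0 < i" "i < n" using Gi Hj pd i(1)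
    by (auto simp: j_def intro!: gr0I le_neq_implies_less)
  have "n * a \<noteq> k * i"
  proof
    assume "n * a = k * i"
    then have "n dvd k * i" by (metis dvd_triv_left)
    moreover have "coprime n k" using kn by (simp add: coprime_iff_gcd_eq_1 gcd.commute)
    ultimately have "n dvd i" by (simp add: coprime_dvd_mult_right_iff)
    then show False using ij by (auto dest: dvd_imp_le)
  qed
  moreover have "n * a + n * b \<le> k * i + k * j"
  proof -
    have "n * a + n * b \<le> n * k" using ab by (simp flip: add_mult_distrib2)
    also have "n * k = k * i + k * j" using i(1) by (simp add: j_def flip: add_mult_distrib2)
    finally show ?thesis .
  qed
  ultimately consider "n * a < k * i" | "n * b < k * j" by linarith
  then show False
  proof cases
    case 1
    obtain t e where "\<not> p ^ Suc e dvd fps_nth (G * H) t"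
      "n * e + k * t \<le> (n * a + k * 0) + (n * 0 + k * j)"
      using weight_mult_le[OF p n nG Hj] by blast
    moreover have "n * k = k * i + k * j" using i(1) by (simp add: j_def flip: add_mult_distrib2)
    ultimately show False using 1 weight[of e t] by simp
  next
    case 2
    obtain t e where "\<not> p ^ Suc e dvd fps_nth (G * H) t"
      "n * e + k * t \<le> (n * 0 + k * i) + (n * b + k * 0)"
      using weight_mult_le[OF p n Gi nH] by blast
    moreover have "n * k = k * i + k * j" using i(1) by (simp add: j_def flip: add_mult_distrib2)
    ultimately show False using 2 weight[of e t] by simp
  qed
qed

section \<open>From valuations to divisibility\<close>

lemma val_to_fract:
  fixes x :: "'a::pid"
  assumes p: "prime_elem p" and x: "x = p ^ v * b" "\<not> p dvd b"
  shows "val p (to_fract x) = ereal (real v)"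
proof -
  have "b \<noteq> 0" "\<not> p dvd 1" using x p by (auto simp: prime_elem_def)
  then have "to_fract b \<in> localization_at (principal_ideal p)"
    "inverse (to_fract b) \<in> localization_at (principal_ideal p)"
    unfolding localization_iff using x(2) by (auto simp: to_fract_def)
  then have "val p (to_fract p powi int v * to_fract b) = ereal (of_int (int v))"
    using \<open>b \<noteq> 0\<close> by (intro val_eqI p) auto
  then show ?thesis by (simp add: x(1) to_fract_power')
qed

lemma not_dvd_of_val_eq_0:
  fixes x :: "'a::pid"
  assumes p: "prime_elem p" and v: "val p (to_fract x) = 0"
  shows "\<not> p dvd x"
proof -
  have "x \<noteq> 0" using v by (auto simp: val_def)
  then obtain e b where x: "x = p ^ e * b" "\<not> p dvd b"
    using pid_prime_power_exponent[OF p] by blast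
  with val_to_fract[OF p x] v have "e = 0" by (simp add: zero_ereal_def)
  with x show ?thesis by simp
qed

lemma weight_less_of_slope:
  fixes x :: "'a::pid"
  assumes p: "prime_elem p" and t: "t < n"
    and slope: "ereal (real k / real n) < val p (to_fract x) / ereal (real n - real t)"
    and e: "\<not> p ^ Suc e dvd x"
  shows "n * k < n * e + k * t"
proof -
  have "x \<noteq> 0" using e by auto
  then obtain v b where x: "x = p ^ v * b" "\<not> p dvd b"
    using pid_prime_power_exponent[OF p] by blast
  have "p ^ v dvd x" by (simp add: x)
  then have "v \<le> e" using e by (meson dvd_trans le_imp_power_dvd not_less_eq_eq)
  have "real k / real n < real v / (real n - real t)"
    using slope t unfolding val_to_fract[OF p x] by (simp add: ereal_divide)
  then have "real k * (real n - real t) < real v * real n"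
    using t by (simp add: field_simps)
  then have "real (n * k) < real (n * v + k * t)" by (simp add: algebra_simps)
  then have "n * k < n * v + k * t" by linarith
  also have "\<dots> \<le> n * e + k * t" using \<open>v \<le> e\<close> by simp
  finally show ?thesis .
qed

section \<open>Counting factors\<close>

text \<open>Double counting of the pairs in a relation between \<open>I\<close> and \<open>M\<close>.\<close>

lemma sum_mset_card_eq_sum_size_filter:
  assumes "finite I"
  shows "(\<Sum>g\<in>#M. card {i \<in> I. P i g}) = (\<Sum>i\<in>I. size (filter_mset (P i) M))"
proof (induction M)
  case (add g M)
  have "(\<Sum>i\<in>I. size (filter_mset (P i) (add_mset g M)))
      = (\<Sum>i\<in>I. (if P i g then 1 else 0) + size (filter_mset (P i) M))"
    by (rule sum.cong) auto
  also have "\<dots> = card {i \<in> I. P i g} + (\<Sum>i\<in>I. size (filter_mset (P i) M))"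
    using assms by (simp add: sum.distrib sum.If_cases Int_def)
  finally show ?case using add by simp
qed simp

lemma prime_elem_dvd_prod_mset_fps_nth_0:
  fixes M :: "'a::comm_ring_1 fps multiset"
  assumes p: "prime_elem p" and "p dvd fps_nth (\<Prod>\<^sub># M) 0"
  shows "\<exists>g\<in>#M. p dvd fps_nth g 0"
  using assms(2)
proof (induction M)
  case empty
  then show ?case using p by (auto dest: prime_elem_not_unit)
next
  case (add g M)
  then show ?case using p by (auto simp: prime_elem_dvd_mult_iff)
qed

text \<open>
  In a factorization with the largest number of nonunit factors, a reducible factor could be split
  to obtain a longer one.
\<close>

lemma bounded_nonunit_factorizations_imp_irreducible_factorization:
  fixes f :: "'a::comm_semiring_1"
  assumes "f \<noteq> 0" "\<not> f dvd 1"
    and bound: "\<And>M. f = \<Prod>\<^sub># M \<Longrightarrow> \<forall>g\<in>#M. \<not> g dvd 1 \<Longrightarrow> size M \<le> r"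
  shows "\<exists>M. f = \<Prod>\<^sub># M \<and> (\<forall>g\<in>#M. irreducible g)"
proof -
  define P where "P M \<longleftrightarrow> f = \<Prod>\<^sub># M \<and> (\<forall>g\<in>#M. \<not> g dvd 1)" for M
  have "P {#f#}" using assms by (simp add: P_def)
  moreover have "\<forall>M. P M \<longrightarrow> size M < Suc r" using bound by (simp add: P_def less_Suc_eq_le)
  ultimately have "\<exists>M. P M \<and> (\<forall>M'. P M' \<longrightarrow> size M' \<le> size M)"
    by (rule Lattices_Big.ex_has_greatest_nat)
  then obtain M where M: "P M" "\<And>M'. P M' \<Longrightarrow> size M' \<le> size M" by blast
  have "irreducible g" if g: "g \<in># M" for g
  proof (rule irreducibleI)
    obtain M' where M': "M = add_mset g M'" using g by (metis mset_add)
    show "g \<noteq> 0" using M(1) \<open>f \<noteq> 0\<close> by (auto simp: P_def M')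
    show "\<not> g dvd 1" using M(1) g by (simp add: P_def)
    fix a b assume ab: "g = a * b"
    show "a dvd 1 \<or> b dvd 1"
    proof (rule ccontr)
      assume "\<not> (a dvd 1 \<or> b dvd 1)"
      then have "P (add_mset a (add_mset b M'))"
        using M(1) by (auto simp: P_def M' ab mult_ac)
      then show False using M(2) by (force simp: M')
    qed
  qed
  then show ?thesis using M(1) unfolding P_def by blast
qed

theorem theorem10:
  fixes f :: "'a::pid fps" and u :: 'a and p :: "nat \<Rightarrow> 'a" and k :: "nat \<Rightarrow> nat" and r :: nat
  assumes "r \<ge> 2"
    and "u dvd 1"
    and "\<And>i. i \<in> {1..r} \<Longrightarrow> prime_elem (p i)"
    and "\<And>i j. i \<in> {1..r} \<Longrightarrow> j \<in> {1..r} \<Longrightarrow> i \<noteq> j \<Longrightarrow> \<not> associates (p i) (p j)"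
    and "\<And>i. i \<in> {1..r} \<Longrightarrow> k i > 0"
    and "fps_nth f 0 = u * (\<Prod>i\<in>{1..r}. p i ^ k i)"
    and "\<And>i. i \<in> {1..r} \<Longrightarrow> \<exists>n::nat. n > 0 \<and>
           val (p i) (to_fract (fps_nth f n)) = 0 \<and> gcd (k i) n = 1 \<and>
           (\<forall>t\<in>{1..n-1}. ereal (real (k i) / real n)
              < val (p i) (to_fract (fps_nth f t)) / ereal (real n - real t))"
  shows "(\<exists>M. f = \<Prod>\<^sub># M \<and> (\<forall>g\<in>#M. irreducible g) \<and> size M = r) \<and>
         (\<forall>M. f = \<Prod>\<^sub># M \<and> (\<forall>g\<in>#M. irreducible g) \<longrightarrow> size M = r)"
proof -
  define I where "I = {1..r}"
  have fin: "finite I" and cardI: "card I = r" by (simp_all add: I_def)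
  have prime: "prime_elem (p i)" if "i \<in> I" for i using assms(3) that by (simp add: I_def)
  have nonassoc: "i = j" if "i \<in> I" "j \<in> I" "associates (p i) (p j)" for i j
    using assms(4) that unfolding I_def by blast
  have f0: "fps_nth f 0 = u * (\<Prod>i\<in>I. p i ^ k i)" using assms(6) by (simp add: I_def)
  have u0: "u \<noteq> 0" using assms(2) by auto
  have f0_nz: "fps_nth f 0 \<noteq> 0"
    using u0 fin prime prime_elem_not_zeroI by (auto simp: f0)
  have p_dvd_f0: "p i dvd fps_nth f 0" if "i \<in> I" for i
  proof -
    have "p i dvd p i ^ k i" using assms(5) that by (simp add: I_def dvd_power)
    also have "\<dots> dvd (\<Prod>i\<in>I. p i ^ k i)" using fin that by (rule dvd_prodI)
    finally show ?thesis by (simp add: f0)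
  qed
  \<comment> \<open>The Newton polygon condition at one prime; the bound on weights comes from the exact power
      of the prime in degree 0, from the slope condition strictly between 0 and \<open>n\<close>, and is
      automatic from degree \<open>n\<close> on.\<close>
  have not_both: "\<not> (p i dvd fps_nth G 0 \<and> p i dvd fps_nth H 0)"
    if i: "i \<in> I" and GH: "f = G * H" for i G H
  proof -
    obtain n where n: "n > 0" "val (p i) (to_fract (fps_nth f n)) = 0" "gcd (k i) n = 1"
      and slope: "\<forall>t\<in>{1..n-1}. ereal (real (k i) / real n)
              < val (p i) (to_fract (fps_nth f t)) / ereal (real n - real t)"
      using assms(7)[OF i[unfolded I_def]] by (elim exE conjE)
    have split: "fps_nth f 0 = p i ^ k i * (u * (\<Prod>j\<in>I - {i}. p j ^ k j))"
      using fin i by (simp add: f0 prod.remove mult_ac)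
    have "\<not> p i dvd u * (\<Prod>j\<in>I - {i}. p j ^ k j)"
    proof
      assume "p i dvd u * (\<Prod>j\<in>I - {i}. p j ^ k j)"
      then obtain j where "j \<in> I - {i}" "p j dvd p i"
        using nonunit_dvd_imp_prime_dvd[of "I - {i}" p u "p i" k] fin prime assms(2) i
          prime_elem_not_unit by blast
      then show False
        using prime_dvd_prime_imp_associates[of "p i" "p j"] prime nonassoc i by blast
    qed
    moreover have "p i \<noteq> 0" using prime[OF i] by auto
    ultimately have "\<not> p i ^ Suc (k i) dvd fps_nth f 0"
      unfolding split by (simp only: power_Suc2 dvd_mult_cancel_left) auto
    moreover have "n * k i \<le> n * e + k i * t" if e: "\<not> p i ^ Suc e dvd fps_nth f t" for t e
    proof -
      consider "t = 0" | "t \<in> {1..n-1}" | "n \<le> t" by fastforce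
      then show ?thesis
      proof cases
        case 1
        have "p i ^ k i dvd fps_nth f 0" by (simp add: split)
        then have "\<not> Suc e \<le> k i" using e 1 by (meson dvd_trans le_imp_power_dvd)
        then show ?thesis using 1 by simp
      next
        case 2
        then have "t < n" by auto
        then show ?thesis
          using weight_less_of_slope[OF prime[OF i] _ bspec[OF slope 2] e] by simp
      next
        case 3
        then show ?thesis by (simp add: mult.commute trans_le_add2)
      qed
    qed
    ultimately show ?thesis
      using prime_not_dvd_both_const_coeffs[OF prime[OF i] n(1,3), of G H]
        not_dvd_of_val_eq_0[OF prime[OF i] n(2)] unfolding GH by blast
  qed
  have at_most_one: "size (filter_mset (\<lambda>g. p i dvd fps_nth g 0) M) \<le> 1"
    if i: "i \<in> I" and M: "f = \<Prod>\<^sub># M" for i M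
  proof (rule ccontr)
    define F where "F = filter_mset (\<lambda>g. p i dvd fps_nth g 0) M"
    assume "\<not> size (filter_mset (\<lambda>g. p i dvd fps_nth g 0) M) \<le> 1"
    then have "size F = Suc (Suc (size F - 2))" by (simp add: F_def)
    then obtain g F1 where F1: "F = add_mset g F1" by (blast dest: size_eq_Suc_imp_eq_union)
    with \<open>size F = _\<close> have "size F1 = Suc (size F - 2)" by simp
    then obtain h F' where F: "F = add_mset g (add_mset h F')"
      using F1 by (blast dest: size_eq_Suc_imp_eq_union)
    have "g \<in># F" "h \<in># F" by (simp_all add: F)
    then have gh: "p i dvd fps_nth g 0" "p i dvd fps_nth h 0" by (simp_all add: F_def)
    have "F \<subseteq># M" by (simp add: F_def)
    then obtain M' where "M = F + M'" by (metis subset_mset.add_diff_inverse)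
    then have "f = g * (h * \<Prod>\<^sub># (F' + M'))" by (simp add: M F mult_ac)
    moreover have "p i dvd fps_nth (h * \<Prod>\<^sub># (F' + M')) 0" using gh(2) by simp
    ultimately show False using not_both[OF i] gh(1) by blast
  qed
  have some_prime: "\<exists>i\<in>I. p i dvd fps_nth g 0"
    if M: "f = \<Prod>\<^sub># M" and g: "g \<in># M" "\<not> g dvd 1" for M g
  proof (rule nonunit_dvd_imp_prime_dvd[OF fin prime assms(2)])
    show "\<not> fps_nth g 0 dvd 1" using g(2) by (simp add: fps_dvd_1_iff_nth_0)
    obtain h where "f = g * h" using g(1) M by (metis dvd_def dvd_prod_mset)
    then show "fps_nth g 0 dvd u * (\<Prod>i\<in>I. p i ^ k i)" by (simp flip: f0)
  qed
  have count: "(\<Sum>g\<in>#M. card {i \<in> I. p i dvd fps_nth g 0})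
      = (\<Sum>i\<in>I. size (filter_mset (\<lambda>g. p i dvd fps_nth g 0) M))" for M
    by (rule sum_mset_card_eq_sum_size_filter[OF fin])
  have bound: "size M \<le> r" if M: "f = \<Prod>\<^sub># M" "\<forall>g\<in>#M. \<not> g dvd 1" for M
  proof -
    have "size M = (\<Sum>g\<in>#M. 1)" by simp
    also have "\<dots> \<le> (\<Sum>g\<in>#M. card {i \<in> I. p i dvd fps_nth g 0})"
    proof (rule sum_mset_mono)
      fix g assume "g \<in># M"
      then have "{i \<in> I. p i dvd fps_nth g 0} \<noteq> {}" using some_prime M by blast
      then show "1 \<le> card {i \<in> I. p i dvd fps_nth g 0}"
        using fin by (simp add: Suc_le_eq card_gt_0_iff)
    qed
    also have "\<dots> \<le> (\<Sum>i\<in>I. 1)"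
      unfolding count by (rule sum_mono, rule at_most_one[OF _ M(1)])
    finally show ?thesis by (simp add: cardI)
  qed
  have exact: "size M = r" if M: "f = \<Prod>\<^sub># M" "\<forall>g\<in>#M. irreducible g" for M
  proof -
    have one: "card {i \<in> I. p i dvd fps_nth g 0} = 1" if g: "g \<in># M" for g
    proof -
      have "irreducible g" using M(2) g by blast
      then obtain i where i: "i \<in> I" "p i dvd fps_nth g 0"
        using some_prime[OF M(1) g irreducible_not_unit] by blast
      obtain h where "f = g * h" using g M(1) by (metis dvd_def dvd_prod_mset)
      then have "fps_nth g 0 \<noteq> 0" using f0_nz by auto
      then have "{i \<in> I. p i dvd fps_nth g 0} = {i}"
        using irreducible_fps_const_primes_eq[OF \<open>irreducible g\<close>] prime nonassoc i by blast
      then show ?thesis by simp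
    qed
    have "size M = (\<Sum>g\<in>#M. 1)" by simp
    also have "\<dots> = (\<Sum>g\<in>#M. card {i \<in> I. p i dvd fps_nth g 0})"
      using one by (intro arg_cong[of _ _ sum_mset] image_mset_cong) simp
    also have "\<dots> = (\<Sum>i\<in>I. 1)"
      unfolding count
    proof (rule sum.cong[OF refl])
      fix i assume i: "i \<in> I"
      obtain g where "g \<in># M" "p i dvd fps_nth g 0"
        using prime_elem_dvd_prod_mset_fps_nth_0[OF prime[OF i]] p_dvd_f0[OF i] M(1) by blast
      then have "filter_mset (\<lambda>g. p i dvd fps_nth g 0) M \<noteq> {#}" by (auto simp: filter_mset_eq_conv)
      then have "0 < size (filter_mset (\<lambda>g. p i dvd fps_nth g 0) M)"
        by (simp only: nonempty_has_size)
      then show "size (filter_mset (\<lambda>g. p i dvd fps_nth g 0) M) = 1"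
        using at_most_one[OF i M(1)] by simp
    qed
    finally show ?thesis by (simp add: cardI)
  qed
  have "f \<noteq> 0" using f0_nz by auto
  moreover have "\<not> f dvd 1"
  proof
    assume "f dvd 1"
    then have "fps_nth f 0 dvd 1" by (simp add: fps_dvd_1_iff_nth_0)
    moreover have "1 \<in> I" using assms(1) by (simp add: I_def)
    ultimately show False using p_dvd_f0 prime prime_elem_not_unit dvd_trans by blast
  qed
  ultimately obtain M where "f = \<Prod>\<^sub># M" "\<forall>g\<in>#M. irreducible g"
    using bounded_nonunit_factorizations_imp_irreducible_factorization[OF _ _ bound] by blast
  then show ?thesis using exact by blast
qed

end
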